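(* Let $0\le\alpha<1$ and let $p\ge q\ge2$ and $n$ be integers with $p+q\le n-1$. Let $B^3_{n,p,q}=B^1_{n,p,q}-\{(v_n,v_p)\}+\{(v_n,v_1)\}$. Then $\lambda_\alpha(B^3_{n,p,q})>\lambda_\alpha(B^1_{n,p,q})$.
   Context: All digraphs are simple. For a digraph $G$, $A(G)$ is its adjacency matrix and $D(G)$ the diagonal matrix of outdegrees; $A_\alpha(G)=\alpha D(G)+(1-\alpha)A(G)$ and $\lambda_\alpha(G)$ is the largest modulus of an eigenvalue of $A_\alpha(G)$. $\overleftrightarrow{K_{p,q}}$ is the complete bipartite digraph obtained from $K_{p,q}$ by replacing each edge with a pair of opposite arcs, with parts $V_p=\{v_1,\ldots,v_p\}$ and $V_q=\{v_{p+1},\ldots,v_{p+q}\}$; let $v_{p+q+1},\ldots,v_n$ be new vertices. $B^1_{n,p,q}$ is obtained from $\overleftrightarrow{K_{p,q}}$ by adding the directed path $v_1v_{p+q+1}v_{p+q+2}\cdots v_nv_p$. $G-\{e\}+\{f\}$ denotes deleting arc $e$ and adding arc $f$. *)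

theory Defs
  imports
    "Graph_Theory.Graph_Theory"
    "Jordan_Normal_Form.Spectral_Radius"
begin

text \<open>
  Rows and columns of the matrices of a digraph are indexed by its vertices in increasing order;
  for vertex set \<open>{1..n}\<close>, the vertex number \<open>i\<close> has matrix index \<open>i - 1\<close>.
\<close>

definition vertex_at :: "('a::linorder, 'b) pre_digraph \<Rightarrow> nat \<Rightarrow> 'a" where
  "vertex_at G i = sorted_list_of_set (verts G) ! i"

definition adjacency_matrix :: "('a::linorder, 'b) pre_digraph \<Rightarrow> real mat" where
  "adjacency_matrix G = mat (card (verts G)) (card (verts G))
     (\<lambda>(i, j). if (vertex_at G i, vertex_at G j) \<in> arcs_ends G then 1 else 0)"

definition outdegree_matrix :: "('a::linorder, 'b) pre_digraph \<Rightarrow> real mat" where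
  "outdegree_matrix G = mat_diag (card (verts G)) (\<lambda>i. real (out_degree G (vertex_at G i)))"

definition A_alpha :: "real \<Rightarrow> ('a::linorder, 'b) pre_digraph \<Rightarrow> real mat" where
  "A_alpha \<alpha> G = \<alpha> \<cdot>\<^sub>m outdegree_matrix G + (1 - \<alpha>) \<cdot>\<^sub>m adjacency_matrix G"

definition lambda_alpha :: "real \<Rightarrow> ('a::linorder, 'b) pre_digraph \<Rightarrow> real" where
  "lambda_alpha \<alpha> G = spectral_radius (map_mat complex_of_real (A_alpha \<alpha> G))"

definition complete_bipartite_digraph :: "nat \<Rightarrow> nat \<Rightarrow> (nat, nat \<times> nat) pre_digraph" where
  "complete_bipartite_digraph p q = with_proj
     \<lparr> pverts = {1..p + q},
       parcs = {1..p} \<times> {p + 1..p + q} \<union> {p + 1..p + q} \<times> {1..p} \<rparr>"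

definition add_path :: "('a, 'a \<times> 'a) pre_digraph \<Rightarrow> 'a list \<Rightarrow> ('a, 'a \<times> 'a) pre_digraph" where
  "add_path G xs = G\<lparr> verts := verts G \<union> set xs, arcs := arcs G \<union> set (vwalk_arcs xs) \<rparr>"

definition B1 :: "nat \<Rightarrow> nat \<Rightarrow> nat \<Rightarrow> (nat, nat \<times> nat) pre_digraph" where
  "B1 n p q = add_path (complete_bipartite_digraph p q) (1 # [p + q + 1..<n + 1] @ [p])"

definition B3 :: "nat \<Rightarrow> nat \<Rightarrow> nat \<Rightarrow> (nat, nat \<times> nat) pre_digraph" where
  "B3 n p q = pre_digraph.add_arc (pre_digraph.del_arc (B1 n p q) (n, p)) (n, 1)"

end

theory Submission
  imports Defs
begin

text \<open>
  Both digraphs have an eigenvector that is constant on \<open>V\<^sub>p - {v\<^sub>1}\<close> and on \<open>V\<^sub>q\<close> and geometric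
  along the path, so the eigenvalue equations reduce to a scalar equation in \<open>t\<close>. For \<open>B1\<close> it has a
  root \<open>t\<close> whose eigenvector is positive, hence \<open>t\<close> bounds the spectral radius. There the entry at
  \<open>v\<^sub>1\<close> exceeds the entry at \<open>v\<^sub>p\<close>, which makes the scalar function of \<open>B3\<close> negative at \<open>t\<close>; as that
  function is eventually positive, \<open>B3\<close> has a real eigenvalue larger than \<open>t\<close>.
\<close>

section \<open>Action of \<open>A_alpha\<close> on vectors\<close>

lemma A_alpha_carrier: "A_alpha \<alpha> G \<in> carrier_mat (card (verts G)) (card (verts G))"
  unfolding A_alpha_def adjacency_matrix_def outdegree_matrix_def by (simp add: mat_diag_def)

lemma vertex_at_atLeastAtMost:
  assumes "verts G = {1..n}" "i < n"
  shows "vertex_at G i = Suc i"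
proof -
  have "{1..n} = {1..<Suc n}" by auto
  then have "sorted_list_of_set (verts G) = [1..<Suc n]"
    using assms(1) by (simp only: sorted_list_of_set_range)
  then show ?thesis using assms(2) by (simp add: vertex_at_def del: upt_Suc)
qed

text \<open>The diagonal entry counts the out-neighbours, so the term
  \<open>\<alpha> * x (Suc i)\<close> can be charged once to each outgoing arc. This turns a matrix
  row into a single sum over out-neighbours, which is evaluated below for each kind of
  vertex.\<close>

lemma A_alpha_mult_vec:
  fixes G :: "(nat, nat \<times> nat) pre_digraph" and x :: "nat \<Rightarrow> real"
  assumes V: "verts G = {1..n}" and T: "tail G = fst" "head G = snd"
    and E: "arcs G \<subseteq> {1..n} \<times> {1..n}" and i: "i < n"
  shows "(A_alpha \<alpha> G *\<^sub>v vec n (\<lambda>i. x (Suc i))) $ i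
    = (\<Sum>w | (Suc i, w) \<in> arcs G. \<alpha> * x (Suc i) + (1 - \<alpha>) * x w)"
proof -
  let ?N = "{w. (Suc i, w) \<in> arcs G}"
  let ?d = "real (out_degree G (Suc i))"
  have ends: "arcs_ends G = arcs G"
    using T by (auto simp: arcs_ends_def arc_to_ends_def)
  have "out_arcs G (Suc i) = Pair (Suc i) ` ?N"
    using T by (auto simp: out_arcs_def)
  then have d: "out_degree G (Suc i) = card ?N"
    by (simp add: out_degree_def card_image inj_on_def)
  have N: "?N \<subseteq> {1..n}" using E by auto
  have entry: "A_alpha \<alpha> G $$ (i, j) = (if i = j then \<alpha> * ?d else 0)
      + (if Suc j \<in> ?N then 1 - \<alpha> else 0)" if "j < n" for j
    using that i V vertex_at_atLeastAtMost[OF V]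
    by (auto simp: A_alpha_def adjacency_matrix_def outdegree_matrix_def mat_diag_def ends)
  have "(A_alpha \<alpha> G *\<^sub>v vec n (\<lambda>i. x (Suc i))) $ i
      = (\<Sum>j<n. A_alpha \<alpha> G $$ (i, j) * x (Suc j))"
    using A_alpha_carrier[of \<alpha> G] i V
    by (auto simp: scalar_prod_def lessThan_atLeast0 intro!: sum.cong)
  also have "\<dots> = (\<Sum>j<n. (if i = j then \<alpha> * ?d * x (Suc j) else 0)
      + (if Suc j \<in> ?N then (1 - \<alpha>) * x (Suc j) else 0))"
    by (intro sum.cong) (auto simp: entry algebra_simps)
  also have "\<dots> = \<alpha> * ?d * x (Suc i) + (\<Sum>j<n. if Suc j \<in> ?N then (1 - \<alpha>) * x (Suc j) else 0)"
    using i by (simp add: sum.distrib)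
  also have "(\<Sum>j<n. if Suc j \<in> ?N then (1 - \<alpha>) * x (Suc j) else 0)
      = (\<Sum>w\<in>{1..n}. if w \<in> ?N then (1 - \<alpha>) * x w else 0)"
    by (rule sum.reindex_bij_witness[of _ "\<lambda>w. w - 1" Suc]) auto
  also have "\<dots> = (\<Sum>w\<in>?N. (1 - \<alpha>) * x w)"
    using N by (subst sum.inter_restrict[symmetric]) (auto intro!: sum.cong)
  finally show ?thesis by (simp add: sum.distrib d)
qed

section \<open>Bounds on the spectral radius from real eigenvectors\<close>

text \<open>Take an eigenvector \<open>v\<close> for an eigenvalue of maximal modulus and the least
  \<open>c\<close> with |v| \<le> c x entrywise. Equality holds at some index \<open>k\<close>, and
  the triangle inequality in row \<open>k\<close> compares the modulus of the eigenvalue with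
  \<open>t\<close>.\<close>

lemma spectral_radius_le_positive_eigenvector:
  fixes A :: "real mat" and x :: "real vec"
  assumes A: "A \<in> carrier_mat n n" and n: "n > 0"
    and nonneg: "\<And>i j. i < n \<Longrightarrow> j < n \<Longrightarrow> A $$ (i, j) \<ge> 0"
    and x: "x \<in> carrier_vec n" and pos: "\<And>i. i < n \<Longrightarrow> x $ i > 0"
    and eig: "A *\<^sub>v x = t \<cdot>\<^sub>v x"
  shows "spectral_radius (map_mat complex_of_real A) \<le> t"
proof -
  let ?A = "map_mat complex_of_real A"
  have cA: "?A \<in> carrier_mat n n" using A by simp
  obtain \<mu> where mu: "\<mu> \<in> spectrum ?A" "spectral_radius ?A = norm \<mu>"
    using spectral_radius_mem_max(1)[OF cA n] by auto
  then obtain v where "eigenvector ?A v \<mu>"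
    by (auto simp: spectrum_def eigenvalue_def)
  then have v: "v \<in> carrier_vec n" "v \<noteq> 0\<^sub>v n" and ev: "?A *\<^sub>v v = \<mu> \<cdot>\<^sub>v v"
    using A by (auto simp: eigenvector_def)
  define c where "c = Max ((\<lambda>i. norm (v $ i) / x $ i) ` {..<n})"
  have c_ge: "norm (v $ i) \<le> c * x $ i" if "i < n" for i
  proof -
    have "norm (v $ i) / x $ i \<le> c" unfolding c_def using that by (intro Max_ge) auto
    then show ?thesis using pos[OF that] by (simp add: field_simps)
  qed
  have "c \<in> (\<lambda>i. norm (v $ i) / x $ i) ` {..<n}"
    unfolding c_def using n by (intro Max_in) auto
  then obtain k where k: "k < n" and ck: "norm (v $ k) = c * x $ k"
    using pos by (force simp: field_simps)
  \<comment> \<open>A nonzero entry of \<open>v\<close> forces \<open>c > 0\<close>, so that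
    \<open>c * x $ k\<close> can be cancelled at the end.\<close>
  obtain l where l: "l < n" "v $ l \<noteq> 0"
    using v by (metis carrier_vecD eq_vecI index_zero_vec(1) index_zero_vec(2))
  have "0 < c * x $ l" using c_ge[OF l(1)] l(2) by (meson order_less_le_trans zero_less_norm_iff)
  then have c: "c > 0" using pos[OF l(1)] by (simp add: zero_less_mult_iff)
  have "norm \<mu> * (c * x $ k) = norm ((?A *\<^sub>v v) $ k)"
    using v k ck by (simp add: ev norm_mult)
  also have "(?A *\<^sub>v v) $ k = (\<Sum>j<n. complex_of_real (A $$ (k, j)) * v $ j)"
    using A k v by (auto simp: scalar_prod_def lessThan_atLeast0 intro!: sum.cong)
  also have "norm \<dots> \<le> (\<Sum>j<n. A $$ (k, j) * (c * x $ j))"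
    using nonneg k c_ge
    by (intro sum_norm_le) (auto simp: norm_mult intro!: mult_left_mono)
  also have "\<dots> = c * (\<Sum>j<n. A $$ (k, j) * x $ j)"
    by (simp add: sum_distrib_left algebra_simps)
  also have "(\<Sum>j<n. A $$ (k, j) * x $ j) = (A *\<^sub>v x) $ k"
    using A k x by (auto simp: scalar_prod_def lessThan_atLeast0 intro!: sum.cong)
  also have "c * \<dots> = t * (c * x $ k)"
    using x k by (simp add: eig)
  finally show ?thesis
    using c pos[OF k] mu(2) by (simp add: mult_le_cancel_right)
qed

lemma eigenvector_le_spectral_radius:
  fixes A :: "real mat" and x :: "real vec"
  assumes A: "A \<in> carrier_mat n n" and n: "n > 0"
    and x: "x \<in> carrier_vec n" "x \<noteq> 0\<^sub>v n" and eig: "A *\<^sub>v x = t \<cdot>\<^sub>v x"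
  shows "t \<le> spectral_radius (map_mat complex_of_real A)"
proof -
  let ?A = "map_mat complex_of_real A" and ?x = "map_vec complex_of_real x"
  have cA: "?A \<in> carrier_mat n n" using A by simp
  have "?A *\<^sub>v ?x = map_vec complex_of_real (A *\<^sub>v x)"
    by (rule of_real_hom.mult_mat_vec_hom[OF A x(1), symmetric])
  then have "eigenvector ?A ?x (complex_of_real t)"
    using A x by (simp add: eigenvector_def eig of_real_hom.vec_hom_smult)
  then have "norm (complex_of_real t) \<in> norm ` spectrum ?A"
    unfolding spectrum_def eigenvalue_def by blast
  from spectral_radius_mem_max(2)[OF cA n this] show ?thesis by simp
qed

section \<open>Arc sets of the two digraphs\<close>

text \<open>The parameter \<open>e\<close> is the vertex at which the path closes: \<open>p\<close>
  for \<open>B1\<close> and 1 for \<open>B3\<close>. Both digraphs are thus treated by one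
  eigenvector computation.\<close>

definition bipartite_path_arcs :: "nat \<Rightarrow> nat \<Rightarrow> nat \<Rightarrow> nat \<Rightarrow> (nat \<times> nat) set" where
  "bipartite_path_arcs n p q e = {1..p} \<times> {p + 1..p + q} \<union> {p + 1..p + q} \<times> {1..p}
     \<union> {(1, p + q + 1), (n, e)} \<union> {(i, Suc i) | i. p + q < i \<and> i < n}"

lemma set_vwalk_arcs_upt:
  assumes "k < l"
  shows "set (vwalk_arcs ([k..<l] @ [z])) = {(i, Suc i) | i. k \<le> i \<and> Suc i < l} \<union> {(l - 1, z)}"
  using assms
proof (induction "l - k" arbitrary: k)
  case (Suc d)
  show ?case
  proof (cases "Suc k = l")
    case True
    then show ?thesis by auto
  next
    case False
    then have k: "Suc k < l" using Suc.prems by simp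
    \<comment> \<open>Two leading vertices are exposed because \<open>vwalk_arcs\<close> emits an
      arc only for a consecutive pair.\<close>
    then have "[k..<l] = k # Suc k # [Suc (Suc k)..<l]" "[Suc k..<l] = Suc k # [Suc (Suc k)..<l]"
      by (simp_all add: upt_conv_Cons)
    then have "set (vwalk_arcs ([k..<l] @ [z]))
        = insert (k, Suc k) (set (vwalk_arcs ([Suc k..<l] @ [z])))"
      by simp
    also have "set (vwalk_arcs ([Suc k..<l] @ [z]))
        = {(i, Suc i) | i. Suc k \<le> i \<and> Suc i < l} \<union> {(l - 1, z)}"
      using Suc.hyps(1)[of "Suc k"] Suc.hyps(2) k by simp
    finally show ?thesis using k
      by (auto simp: set_eq_iff)
  qed
qed simp

lemma B1_digraph:
  assumes "p + q < n" "1 \<le> p"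
  shows "verts (B1 n p q) = {1..n}" "tail (B1 n p q) = fst" "head (B1 n p q) = snd"
    "arcs (B1 n p q) = bipartite_path_arcs n p q p"
proof -
  have "vwalk_arcs (1 # [p + q + 1..<n + 1] @ [p])
      = (1, p + q + 1) # vwalk_arcs ([p + q + 1..<n + 1] @ [p])"
    using assms by (simp add: upt_conv_Cons del: upt_Suc)
  then have "set (vwalk_arcs (1 # [p + q + 1..<n + 1] @ [p]))
      = insert (1, p + q + 1) ({(i, Suc i) | i. p + q < i \<and> i < n} \<union> {(n, p)})"
    using assms by (simp add: set_vwalk_arcs_upt Suc_le_eq del: upt_Suc)
  then show "arcs (B1 n p q) = bipartite_path_arcs n p q p"
    unfolding B1_def add_path_def complete_bipartite_digraph_def bipartite_path_arcs_def
    by auto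
  show "verts (B1 n p q) = {1..n}"
    using assms by (auto simp: B1_def add_path_def complete_bipartite_digraph_def)
qed (simp_all add: B1_def add_path_def complete_bipartite_digraph_def)

lemma B3_digraph:
  assumes "p + q < n" "1 < p"
  shows "verts (B3 n p q) = {1..n}" "tail (B3 n p q) = fst" "head (B3 n p q) = snd"
    "arcs (B3 n p q) = bipartite_path_arcs n p q 1"
  using assms B1_digraph[of p q n]
  by (auto simp: B3_def pre_digraph.add_arc_def pre_digraph.del_arc_def bipartite_path_arcs_def)

lemma bipartite_path_arcs_subset:
  assumes "p + q < n" "e \<in> {1..p}"
  shows "bipartite_path_arcs n p q e \<subseteq> {1..n} \<times> {1..n}"
  using assms by (auto simp: bipartite_path_arcs_def)

section \<open>Reduction of the eigenvalue equations\<close>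

text \<open>
  The power of \<open>r\<close> counts the arcs from \<open>v\<close> along the path to its end vertex, whose entry is \<open>z\<close>.
\<close>

definition quotient_vec :: "nat \<Rightarrow> nat \<Rightarrow> nat \<Rightarrow> real \<Rightarrow> real \<Rightarrow> real \<Rightarrow> real \<Rightarrow> real \<Rightarrow> nat \<Rightarrow> real" where
  "quotient_vec n p q r x\<^sub>1 u y z v = (if v = 1 then x\<^sub>1 else if v \<le> p then u
     else if v \<le> p + q then y else r ^ (n + 1 - v) * z)"

text \<open>Each class of vertices contributes one equation: \<open>eq1\<close> for vertex 1,
  \<open>eqp\<close> for the rest of the first part, \<open>eqq\<close> for the second part, and
  \<open>r\<close> for every path vertex. All are stated without dividing by a factor, so they can
  be used whatever the signs of the entries.\<close>

lemma A_alpha_quotient_vec: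
  fixes G :: "(nat, nat \<times> nat) pre_digraph" and \<alpha> t x\<^sub>1 u y z :: real
  assumes V: "verts G = {1..n}" and T: "tail G = fst" "head G = snd"
    and E: "arcs G = bipartite_path_arcs n p q e"
    and pq: "p + q < n" "2 \<le> p" "1 \<le> q" and e: "e \<in> {1..p}"
    and z: "z = (if e = 1 then x\<^sub>1 else u)"
    and r: "(t - \<alpha>) * r = 1 - \<alpha>"
    and eq1: "(t - \<alpha> * (real q + 1)) * x\<^sub>1 = (1 - \<alpha>) * (q * y + r ^ (n - p - q) * z)"
    and eqp: "(t - \<alpha> * q) * u = (1 - \<alpha>) * (q * y)"
    and eqq: "(t - \<alpha> * p) * y = (1 - \<alpha>) * (x\<^sub>1 + (real p - 1) * u)"
  defines "x \<equiv> vec n (\<lambda>i. quotient_vec n p q r x\<^sub>1 u y z (Suc i))"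
  shows "A_alpha \<alpha> G *\<^sub>v x = t \<cdot>\<^sub>v x"
proof (rule eq_vecI)
  show "dim_vec (A_alpha \<alpha> G *\<^sub>v x) = dim_vec (t \<cdot>\<^sub>v x)"
    using A_alpha_carrier[of \<alpha> G] V by (simp add: x_def)
  fix i assume "i < dim_vec (t \<cdot>\<^sub>v x)"
  then have i: "i < n" by (simp add: x_def)
  define v where "v = Suc i"
  let ?f = "quotient_vec n p q r x\<^sub>1 u y z"
  let ?N = "{w. (v, w) \<in> arcs G}"
  have v: "1 \<le> v" "v \<le> n" using i by (auto simp: v_def)
  have f1: "?f 1 = x\<^sub>1" and fp: "\<And>w. w \<in> {2..p} \<Longrightarrow> ?f w = u"
    and fq: "\<And>w. w \<in> {p + 1..p + q} \<Longrightarrow> ?f w = y"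
    and fr: "\<And>w. p + q < w \<Longrightarrow> ?f w = r ^ (n + 1 - w) * z"
    using pq by (auto simp: quotient_vec_def)
  have fe: "?f e = z" using e z by (auto simp: quotient_vec_def)
  have sq: "(\<Sum>w = p + 1..p + q. \<alpha> * c + (1 - \<alpha>) * ?f w) = q * (\<alpha> * c + (1 - \<alpha>) * y)" for c
  proof -
    have "(\<Sum>w = p + 1..p + q. \<alpha> * c + (1 - \<alpha>) * ?f w)
        = (\<Sum>w = p + 1..p + q. \<alpha> * c + (1 - \<alpha>) * y)"
      using fq by (intro sum.cong) auto
    then show ?thesis by simp
  qed
  have "(\<Sum>w\<in>?N. \<alpha> * ?f v + (1 - \<alpha>) * ?f w) = t * ?f v"
  proof -
    consider "v = 1" | "v \<in> {2..p}" | "v \<in> {p + 1..p + q}" | "p + q < v" "v < n" | "v = n"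
      using v by (cases "v = 1"; cases "v \<le> p"; cases "v \<le> p + q"; cases "v = n") auto
    then show ?thesis
    proof cases
      case 1
      have "?N = insert (p + q + 1) {p + 1..p + q}"
        using 1 pq unfolding E bipartite_path_arcs_def by auto
      then show ?thesis
        using 1 eq1 pq sq[of x\<^sub>1] f1 fr[of "p + q + 1"] by (simp add: algebra_simps)
    next
      case 2
      have "?N = {p + 1..p + q}"
        using 2 pq unfolding E bipartite_path_arcs_def by auto
      then show ?thesis
        using 2 eqp sq[of u] fp[of v] by (simp add: algebra_simps)
    next
      case 3
      have "?N = insert 1 {2..p}"
        using 3 pq unfolding E bipartite_path_arcs_def by auto
      moreover have "(\<Sum>w = 2..p. \<alpha> * y + (1 - \<alpha>) * ?f w) = (\<Sum>w = 2..p. \<alpha> * y + (1 - \<alpha>) * u)"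
        using fp by (intro sum.cong) auto
      ultimately show ?thesis
        using 3 eqq pq f1 fq[of v] by (simp add: of_nat_diff algebra_simps)
    next
      case 4
      have "?N = {Suc v}"
        using 4 pq unfolding E bipartite_path_arcs_def by auto
      \<comment> \<open>Consecutive path entries differ by one factor \<open>r\<close>; taking out
        the common power leaves the relation that defines \<open>r\<close>.\<close>
      moreover have "n + 1 - v = Suc (n - v)" using 4 by simp
      ultimately have "(\<Sum>w\<in>?N. \<alpha> * ?f v + (1 - \<alpha>) * ?f w) - t * ?f v
          = r ^ (n - v) * z * ((1 - \<alpha>) - (t - \<alpha>) * r)"
        using 4 fr[of v] fr[of "Suc v"] by (simp add: algebra_simps)
      then show ?thesis using r by simp
    next
      case 5
      \<comment> \<open>The last path vertex has exponent 1, and its successor \<open>e\<close>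
        carries \<open>z\<close>, as if the exponent were 0.\<close>
      have "?N = {e}"
        using 5 pq unfolding E bipartite_path_arcs_def by auto
      then have "(\<Sum>w\<in>?N. \<alpha> * ?f v + (1 - \<alpha>) * ?f w) - t * ?f v
          = z * ((1 - \<alpha>) - (t - \<alpha>) * r)"
        using 5 pq fr[of v] fe by (simp add: algebra_simps)
      then show ?thesis using r by simp
    qed
  qed
  moreover have "(A_alpha \<alpha> G *\<^sub>v x) $ i = (\<Sum>w\<in>?N. \<alpha> * ?f v + (1 - \<alpha>) * ?f w)"
    unfolding x_def v_def
    using A_alpha_mult_vec[OF V T _ i] bipartite_path_arcs_subset[OF pq(1) e] E by simp
  ultimately show "(A_alpha \<alpha> G *\<^sub>v x) $ i = (t \<cdot>\<^sub>v x) $ i"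
    using i by (simp add: x_def v_def)
qed

section \<open>Roots of the two scalar equations\<close>

text \<open>This makes the scalar functions of both digraphs positive at \<open>4 * P\<close>. The
  product \<open>U * W * E\<close> contains three copies of \<open>P * W * E\<close>: one absorbs
  \<open>Q * W\<close>, one absorbs \<open>Q * P * E\<close>, and the third leaves the margin
  \<open>Q\<close>.\<close>

lemma cubic_term_dominates:
  fixes P Q U W E c :: real
  assumes Q: "2 \<le> Q" "Q \<le> P" and U: "3 * P \<le> U" and W: "Q \<le> W" and E: "1 \<le> E"
    and c: "c \<le> 1"
  shows "Q \<le> U * W * E - c * Q * (W + (P - 1) * E)"
proof -
  have nonneg: "0 \<le> P" "0 \<le> W" "0 \<le> E" "0 \<le> Q" using assms by auto
  have "3 * P * W * E \<le> U * W * E" using U nonneg by (intro mult_right_mono) auto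
  moreover have "c * (Q * (W + (P - 1) * E)) \<le> 1 * (Q * (W + (P - 1) * E))"
    using c nonneg Q by (intro mult_right_mono) auto
  moreover have "Q * W * 1 \<le> P * W * E" using Q nonneg E by (intro mult_mono) auto
  moreover have "Q * (P * E) \<le> W * (P * E)" using W nonneg by (intro mult_right_mono) auto
  moreover have "Q * 1 * 1 \<le> P * W * E" using Q nonneg E W by (intro mult_mono) auto
  moreover have "0 \<le> Q * E" using nonneg by simp
  ultimately show ?thesis by (simp add: algebra_simps)
qed

text \<open>
  The equation is the \<open>V\<^sub>q\<close> row after the other entries of the eigenvector have been eliminated
  and the denominators cleared, with \<open>m = n - p - q\<close>.
\<close>

lemma B1_characteristic_root:
  fixes a P Q :: real
  assumes a: "0 \<le> a" "a < 1" and Q: "2 \<le> Q" "Q \<le> P"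
  obtains t where "a * P < t" "a * (Q + 1) < t" "t \<le> 4 * P"
    "(t - a * P) * (t - a * Q) * (t - a * (Q + 1)) = (1 - a)\<^sup>2 * Q *
       (t - a * Q + (1 - a) * ((1 - a) / (t - a)) ^ m + (P - 1) * (t - a * (Q + 1)))"
proof -
  define K where "K t = (t - a * P) * (t - a * Q) * (t - a * (Q + 1))
      - (1 - a)\<^sup>2 * Q * (t - a * Q + (P - 1) * (t - a * (Q + 1)))" for t
  \<comment> \<open>Multiplying by \<open>(t - a) ^ m\<close> clears the denominator, so
    \<open>h\<close> is continuous also at \<open>t = a\<close>, which is the left end point
    \<open>l\<close> when \<open>a = 0\<close>.\<close>
  define h where "h t = (t - a) ^ m * K t - (1 - a) ^ (m + 3) * Q" for t
  \<comment> \<open>At \<open>l\<close> the cubic product vanishes while all its factors are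
    nonnegative; the remaining terms make \<open>h\<close> negative.\<close>
  define l where "l = max (a * P) (a * (Q + 1))"
  have l: "a * P \<le> l" "a * (Q + 1) \<le> l" "a \<le> l" "a * Q \<le> l"
  proof -
    show "a * P \<le> l" "a * (Q + 1) \<le> l" by (auto simp: l_def)
    moreover have "a * 1 \<le> a * (Q + 1)" "a * Q \<le> a * (Q + 1)"
      using a Q by (intro mult_left_mono; simp)+
    ultimately show "a \<le> l" "a * Q \<le> l" by linarith+
  qed
  have bounds: "a * P \<le> P" "a * Q \<le> Q" "a * (Q + 1) \<le> Q + 1"
    using a Q by (auto simp: mult_left_le_one_le)
  have hl: "h l < 0"
  proof -
    have "(l - a * P) * (l - a * Q) * (l - a * (Q + 1)) = 0" by (auto simp: l_def max_def)
    moreover have "0 \<le> (1 - a)\<^sup>2 * Q * (l - a * Q + (P - 1) * (l - a * (Q + 1)))"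
      using l Q by simp
    ultimately have "K l \<le> 0" unfolding K_def by linarith
    then have "(l - a) ^ m * K l \<le> 0" using l by (simp add: mult_nonneg_nonpos)
    moreover have "0 < (1 - a) ^ (m + 3) * Q" using a Q by simp
    ultimately show ?thesis by (simp add: h_def)
  qed
  have hT: "0 \<le> h (4 * P)"
  proof -
    define U W E where "U = 4 * P - a * P" and "W = 4 * P - a * Q" and "E = 4 * P - a * (Q + 1)"
    have U: "3 * P \<le> U" and W: "Q \<le> W" and E: "1 \<le> E"
      using bounds Q unfolding U_def W_def E_def by linarith+
    have "(1 - a)\<^sup>2 \<le> 1" using a by (simp add: power_le_one)
    then have K: "Q \<le> K (4 * P)"
      using cubic_term_dominates[OF Q U W E, of "(1 - a)\<^sup>2"]
      unfolding K_def U_def[symmetric] W_def[symmetric] E_def[symmetric] by simp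
    have "1 * Q \<le> (4 * P - a) ^ m * K (4 * P)"
      using K Q a by (intro mult_mono one_le_power) auto
    moreover have "(1 - a) ^ (m + 3) * Q \<le> 1 * Q"
      using a Q by (intro mult_right_mono power_le_one) auto
    ultimately show ?thesis by (simp add: h_def)
  qed
  have "l \<le> 4 * P" unfolding l_def using bounds Q by (intro max.boundedI) linarith+
  moreover have "continuous_on {l..4 * P} h" unfolding h_def K_def by (intro continuous_intros)
  ultimately obtain t where t: "l \<le> t" "t \<le> 4 * P" "h t = 0"
    using IVT'[of h l 0 "4 * P"] hl hT by auto
  \<comment> \<open>Strictness makes every factor of the cubic positive, hence also the eigenvector
    built from \<open>t\<close>.\<close>
  have lt: "l < t" using t hl by (cases "l = t") auto
  then have ta: "0 < t - a" using l by auto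
  have "K t = (1 - a)\<^sup>2 * Q * ((1 - a) * ((1 - a) / (t - a)) ^ m)"
    using t(3) ta by (simp add: h_def field_simps power_add power_divide eval_nat_numeral)
  then show thesis
    using that[of t] lt l t by (simp add: K_def algebra_simps)
qed

text \<open>The scalar function of \<open>B3\<close> is negative at the root \<open>t\<close> of
  \<open>B1\<close> and nonnegative at \<open>4 * P\<close>, so it vanishes beyond
  \<open>t\<close>.\<close>

lemma B3_characteristic_root_gt:
  fixes a P Q t :: real
  assumes a: "0 \<le> a" "a < 1" and Q: "2 \<le> Q" "Q \<le> P"
    and t: "a * P < t" "a * (Q + 1) < t" "t \<le> 4 * P"
    and root: "(t - a * P) * (t - a * Q) * (t - a * (Q + 1)) = (1 - a)\<^sup>2 * Q *
       (t - a * Q + (1 - a) * ((1 - a) / (t - a)) ^ m + (P - 1) * (t - a * (Q + 1)))"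
  obtains s where "t < s"
    "(s - a * P) * (s - a * Q) * (s - a * (Q + 1) - (1 - a) * ((1 - a) / (s - a)) ^ m)
      = (1 - a)\<^sup>2 * Q * (s - a * Q
          + (P - 1) * (s - a * (Q + 1) - (1 - a) * ((1 - a) / (s - a)) ^ m))"
proof -
  define R where "R s = (1 - a) * ((1 - a) / (s - a)) ^ m" for s
  \<comment> \<open>When the path returns to vertex 1, its contribution \<open>R s\<close> moves to
    the left side of that vertex's row and lowers the coefficient to \<open>D s\<close>.\<close>
  define D where "D s = s - a * (Q + 1) - R s" for s
  define g where "g s = (s - a * P) * (s - a * Q) * D s
      - (1 - a)\<^sup>2 * Q * (s - a * Q + (P - 1) * D s)" for s
  have bounds: "a * P \<le> P" "a * Q \<le> Q" "a * (Q + 1) \<le> Q + 1"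
    using a Q by (auto simp: mult_left_le_one_le)
  have "a * 1 \<le> a * (Q + 1)" using a Q by (intro mult_left_mono) auto
  then have ta: "a < t" using t by simp
  have Rt: "0 < R t" using a ta by (simp add: R_def)
  have gt: "g t < 0"
  proof -
    define U W E where "U = t - a * P" and "W = t - a * Q" and "E = t - a * (Q + 1)"
    define c where "c = (1 - a)\<^sup>2 * Q"
    have E: "0 < E" "E \<le> W" and c: "0 < c"
      using a Q t by (auto simp: E_def W_def c_def algebra_simps)
    have UWE: "U * W * E = c * (W + R t + (P - 1) * E)"
      using root by (simp add: U_def W_def E_def c_def R_def)
    \<comment> \<open>Multiplying by \<open>E\<close> produces the cubic product, which the equation
      of \<open>B1\<close> replaces. What survives has the factor \<open>W - E + R t\<close>, that
      is, \<open>E\<close> times the excess of the entry at vertex 1 over the entry 1 at vertex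
      \<open>p\<close> in the eigenvector of \<open>B1\<close>.\<close>
    have "E * g t = (U * W * E) * (E - R t) - c * E * (W + (P - 1) * (E - R t))"
      by (simp add: g_def D_def U_def W_def E_def c_def algebra_simps)
    also have "\<dots> = - (c * R t * (W - E + R t))"
      unfolding UWE by (simp add: algebra_simps)
    also have "\<dots> < 0" using c Rt E by simp
    finally show ?thesis using E(1) by (simp add: mult_less_0_iff)
  qed
  have gT: "0 \<le> g (4 * P)"
  proof -
    define U W E where "U = 4 * P - a * P" and "W = 4 * P - a * Q" and "E = D (4 * P)"
    have "((1 - a) / (4 * P - a)) ^ m \<le> 1" using a Q by (intro power_le_one) auto
    then have "(1 - a) * ((1 - a) / (4 * P - a)) ^ m \<le> 1 * 1"
      using a Q by (intro mult_mono) auto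
    then have "R (4 * P) \<le> 1" by (simp add: R_def)
    then have E: "1 \<le> E" using bounds Q unfolding E_def D_def by linarith
    have U: "3 * P \<le> U" and W: "Q \<le> W"
      using bounds Q unfolding U_def W_def by linarith+
    have "(1 - a)\<^sup>2 \<le> 1" using a by (simp add: power_le_one)
    then have "Q \<le> g (4 * P)"
      using cubic_term_dominates[OF Q U W E, of "(1 - a)\<^sup>2"]
      unfolding g_def U_def[symmetric] W_def[symmetric] E_def[symmetric] by simp
    then show ?thesis using Q by simp
  qed
  have "continuous_on {t..4 * P} g"
    unfolding g_def D_def R_def using ta by (intro continuous_intros) auto
  then obtain s where s: "t \<le> s" "g s = 0"
    using IVT'[of g t 0 "4 * P"] gt gT t by auto
  then have "t < s" using gt by (cases "t = s") auto
  then show thesis using that[of s] s by (simp add: g_def D_def R_def)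
qed

section \<open>Comparison of the spectral radii\<close>

lemma A_alpha_nonneg:
  assumes "0 \<le> \<alpha>" "\<alpha> \<le> 1" "i < card (verts G)" "j < card (verts G)"
  shows "0 \<le> A_alpha \<alpha> G $$ (i, j)"
  using assms by (simp add: A_alpha_def adjacency_matrix_def outdegree_matrix_def mat_diag_def)

theorem theorem4p5:
  fixes \<alpha> :: real and n p q :: nat
  assumes "0 \<le> \<alpha>" and "\<alpha> < 1"
    and "p \<ge> q" and "q \<ge> 2" and "p + q \<le> n - 1"
  shows "lambda_alpha \<alpha> (B3 n p q) > lambda_alpha \<alpha> (B1 n p q)"
proof -
  define m where "m = n - p - q"
  define b where "b = 1 - \<alpha>"
  have b: "0 < b" using assms by (simp add: b_def)
  have pq: "p + q < n" "2 \<le> p" "1 \<le> q" and n: "0 < n" using assms by auto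
  have PQ: "2 \<le> real q" "real q \<le> real p" using assms by auto
  obtain t where t: "\<alpha> * p < t" "\<alpha> * (real q + 1) < t" "t \<le> 4 * real p"
    and root1: "(t - \<alpha> * p) * (t - \<alpha> * q) * (t - \<alpha> * (real q + 1)) = (1 - \<alpha>)\<^sup>2 * q *
      (t - \<alpha> * q + (1 - \<alpha>) * ((1 - \<alpha>) / (t - \<alpha>)) ^ m + (real p - 1) * (t - \<alpha> * (real q + 1)))"
    using B1_characteristic_root[OF assms(1,2) PQ] by blast
  obtain s where s: "t < s"
    and root3: "(s - \<alpha> * p) * (s - \<alpha> * q)
        * (s - \<alpha> * (real q + 1) - (1 - \<alpha>) * ((1 - \<alpha>) / (s - \<alpha>)) ^ m)
      = (1 - \<alpha>)\<^sup>2 * q * (s - \<alpha> * q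
          + (real p - 1) * (s - \<alpha> * (real q + 1) - (1 - \<alpha>) * ((1 - \<alpha>) / (s - \<alpha>)) ^ m))"
    using B3_characteristic_root_gt[OF assms(1,2) PQ t root1] by blast
  have "\<alpha> * 1 \<le> \<alpha> * (real q + 1)" "\<alpha> * q \<le> \<alpha> * (real q + 1)"
    using assms by (intro mult_left_mono; simp)+
  then have ta: "\<alpha> < t" "\<alpha> * q < t" using t by auto
  have "lambda_alpha \<alpha> (B1 n p q) \<le> t"
  proof -
    define r W E where "r = b / (t - \<alpha>)" and "W = t - \<alpha> * q" and "E = t - \<alpha> * (real q + 1)"
    \<comment> \<open>Setting the entry at vertex \<open>p\<close> to 1 fixes \<open>z = 1\<close>;
      the row of that vertex then gives the entry on the second part, and row 1 gives the first
      entry.\<close>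
    define x where "x = vec n (\<lambda>i. quotient_vec n p q r ((W + b * r ^ m) / E) 1 (W / (b * q)) 1 (Suc i))"
    note G = B1_digraph[of p q n]
    have pos: "0 < r" "0 < W" "0 < E" using b ta t by (auto simp: r_def W_def E_def)
    have "A_alpha \<alpha> (B1 n p q) *\<^sub>v x = t \<cdot>\<^sub>v x"
      unfolding x_def
    proof (rule A_alpha_quotient_vec[where e = p])
      show "(t - \<alpha>) * r = 1 - \<alpha>" using ta by (simp add: r_def b_def)
      show "(t - \<alpha> * (real q + 1)) * ((W + b * r ^ m) / E)
          = (1 - \<alpha>) * (q * (W / (b * q)) + r ^ (n - p - q) * 1)"
        using pos b pq unfolding b_def[symmetric] m_def[symmetric] E_def[symmetric]
        by (simp add: field_simps)
      show "(t - \<alpha> * q) * 1 = (1 - \<alpha>) * (q * (W / (b * q)))"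
        using b pq by (simp add: W_def b_def)
      \<comment> \<open>The rows of the second part are the only ones left, and they are the scalar
        equation.\<close>
      have "(t - \<alpha> * p) * W * E = b\<^sup>2 * q * (W + b * r ^ m + (real p - 1) * E)"
        using root1 by (simp add: W_def E_def r_def b_def)
      then show "(t - \<alpha> * p) * (W / (b * q)) = (1 - \<alpha>) * ((W + b * r ^ m) / E + (real p - 1) * 1)"
        using pos b pq unfolding b_def[symmetric]
        by (simp add: field_simps power2_eq_square)
    qed (use G pq in auto)
    moreover have "0 < x $ i" if "i < n" for i
      using that pos b pq by (auto simp: x_def quotient_vec_def add_pos_pos)
    ultimately show ?thesis
      unfolding lambda_alpha_def
      using A_alpha_carrier[of \<alpha> "B1 n p q"] A_alpha_nonneg[of \<alpha> _ "B1 n p q"] G pq n assms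
      by (intro spectral_radius_le_positive_eigenvector[where n = n and x = x]) (auto simp: x_def)
  qed
  moreover have "s \<le> lambda_alpha \<alpha> (B3 n p q)"
  proof -
    define r W D where "r = b / (s - \<alpha>)" and "W = s - \<alpha> * q"
      and "D = s - \<alpha> * (real q + 1) - b * r ^ m"
    \<comment> \<open>The rows of vertices 1 and \<open>p\<close> give
      \<open>D * x\<^sub>1 = W * u\<close>. The choice \<open>W\<close>, \<open>D\<close> avoids
      dividing by \<open>D\<close>, whose sign is not known; a lower bound on the spectral radius
      needs only a nonzero vector, and \<open>W > 0\<close> ensures that.\<close>
    define x where "x = vec n (\<lambda>i. quotient_vec n p q r W D (W * D / (b * q)) W (Suc i))"
    note G = B3_digraph[of p q n]
    have W: "0 < W" using s ta by (simp add: W_def)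
    have "A_alpha \<alpha> (B3 n p q) *\<^sub>v x = s \<cdot>\<^sub>v x"
      unfolding x_def
    proof (rule A_alpha_quotient_vec[where e = 1])
      show "(s - \<alpha>) * r = 1 - \<alpha>" using ta s by (simp add: r_def b_def)
      have "s - \<alpha> * (real q + 1) = D + b * r ^ m" by (simp add: D_def)
      then show "(s - \<alpha> * (real q + 1)) * W = (1 - \<alpha>) * (q * (W * D / (b * q)) + r ^ (n - p - q) * W)"
        using b pq unfolding b_def[symmetric] m_def[symmetric] by (simp add: algebra_simps)
      show "(s - \<alpha> * q) * D = (1 - \<alpha>) * (q * (W * D / (b * q)))"
        using b pq by (simp add: W_def b_def)
      have "(s - \<alpha> * p) * W * D = b\<^sup>2 * q * (W + (real p - 1) * D)"
        using root3 by (simp add: W_def D_def r_def b_def)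
      then show "(s - \<alpha> * p) * (W * D / (b * q)) = (1 - \<alpha>) * (W + (real p - 1) * D)"
        using b pq unfolding b_def[symmetric]
        by (simp add: field_simps power2_eq_square)
    qed (use G pq in auto)
    moreover have "x $ 0 \<noteq> 0" using W n by (simp add: x_def quotient_vec_def)
    then have "x \<noteq> 0\<^sub>v n" using n by auto
    ultimately show ?thesis
      unfolding lambda_alpha_def
      using A_alpha_carrier[of \<alpha> "B3 n p q"] G pq n
      by (intro eigenvector_le_spectral_radius[where n = n and x = x]) (auto simp: x_def)
  qed
  ultimately show ?thesis using s by linarith
qed

end
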